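(* Let $q\in\mathbb{C}^\times$ and let $\widetilde{H}$ be the affine Hecke algebra of type $C_2$. The $1$-dimensional representations $\widetilde{H}\to\mathbb{C}$ are exactly the following, where $\epsilon\in\{1,-1\}$: $L_{q,q,\epsilon}$: $T_1\mapsto q$, $T_2\mapsto q$, $X^{\omega_1}\mapsto\epsilon q^3$, $X^{\omega_2}\mapsto q^4$; $L_{q,-q^{-1},\epsilon}$: $T_1\mapsto q$, $T_2\mapsto-q^{-1}$, $X^{\omega_1}\mapsto\epsilon q$, $X^{\omega_2}\mapsto1$; $L_{-q^{-1},q,\epsilon}$: $T_1\mapsto-q^{-1}$, $T_2\mapsto q$, $X^{\omega_1}\mapsto\epsilon q^{-1}$, $X^{\omega_2}\mapsto1$; $L_{-q^{-1},-q^{-1},\epsilon}$: $T_1\mapsto-q^{-1}$, $T_2\mapsto-q^{-1}$, $X^{\omega_1}\mapsto\epsilon q^{-3}$, $X^{\omega_2}\mapsto q^{-4}$.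
   Context: The type $C_2$ root system has simple roots $\alpha_1,\alpha_2$ with $\langle\alpha_1,\alpha_2^\vee\rangle=-1$, $\langle\alpha_2,\alpha_1^\vee\rangle=-2$; $s_i\lambda=\lambda-\langle\lambda,\alpha_i^\vee\rangle\alpha_i$. The fundamental weights are $\omega_1=\alpha_1+\frac12\alpha_2$, $\omega_2=\alpha_1+\alpha_2$, and $P=\mathbb{Z}\omega_1+\mathbb{Z}\omega_2$. $X=\{X^\lambda\mid\lambda\in P\}$ with $X^\lambda X^\mu=X^{\lambda+\mu}$. The affine Hecke algebra $\widetilde{H}$ is the $\mathbb{C}$-algebra generated by $T_1,T_2$ and $X^\lambda$ ($\lambda\in P$), with the group algebra $\mathbb{C}[X]$ a subalgebra, subject to $T_i^2=(q-q^{-1})T_i+1$, $T_1T_2T_1T_2=T_2T_1T_2T_1$, and $X^\lambda T_i=T_iX^{s_i\lambda}+(q-q^{-1})\frac{X^\lambda-X^{s_i\lambda}}{1-X^{-\alpha_i}}$ for $\lambda\in P$, $i=1,2$. *)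

theory Defs
  imports
    Complex_Main
    "HOL-Library.Poly_Mapping"
    "HOL-Library.Product_Plus"
    "HOL-Algebra.QuotRing"
    "HOL-Algebra.Algebraic_Closure_Type"
begin

section \<open>The weight lattice of type $C_2$\<close>

text \<open>The pair \<open>(a, b)\<close> stands for the weight \<open>a \<omega>\<^sub>1 + b \<omega>\<^sub>2\<close>, so its pairings with the two simple
  coroots are \<open>a\<close> and \<open>b\<close>.  Solving \<open>\<omega>\<^sub>1 = \<alpha>\<^sub>1 + \<alpha>\<^sub>2/2\<close> and \<open>\<omega>\<^sub>2 = \<alpha>\<^sub>1 + \<alpha>\<^sub>2\<close> for the simple roots gives
  \<open>\<alpha>\<^sub>1 = 2 \<omega>\<^sub>1 - \<omega>\<^sub>2\<close> and \<open>\<alpha>\<^sub>2 = -2 \<omega>\<^sub>1 + 2 \<omega>\<^sub>2\<close>.\<close>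

type_synonym weight = "int \<times> int"

datatype node = N1 | N2

fun omega :: "node \<Rightarrow> weight" where
  "omega N1 = (1, 0)"
| "omega N2 = (0, 1)"

fun alpha :: "node \<Rightarrow> weight" where
  "alpha N1 = (2, -1)"
| "alpha N2 = (-2, 2)"

fun pairing :: "weight \<Rightarrow> node \<Rightarrow> int" where
  "pairing \<nu> N1 = fst \<nu>"
| "pairing \<nu> N2 = snd \<nu>"

definition int_scale :: "int \<Rightarrow> weight \<Rightarrow> weight" where
  "int_scale k \<nu> = (k * fst \<nu>, k * snd \<nu>)"

definition reflection :: "node \<Rightarrow> weight \<Rightarrow> weight" where
  "reflection i \<nu> = \<nu> - int_scale (pairing \<nu> i) (alpha i)"

lemma cartan_matrix:
  "pairing (alpha N1) N1 = 2" "pairing (alpha N1) N2 = -1"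
  "pairing (alpha N2) N1 = -2" "pairing (alpha N2) N2 = 2"
  by simp_all

lemma fundamental_weights:
  "int_scale 2 (omega N1) = int_scale 2 (alpha N1) + alpha N2"
  "omega N2 = alpha N1 + alpha N2"
  by (simp_all add: int_scale_def)

section \<open>The group algebra of the weight lattice\<close>

type_synonym group_algebra = "weight \<Rightarrow>\<^sub>0 complex"

abbreviation xpow :: "weight \<Rightarrow> group_algebra" where
  "xpow \<nu> \<equiv> Poly_Mapping.single \<nu> 1"

text \<open>The fraction in the cross relation denotes the exact quotient in the group algebra; it is
  well defined by \<open>bl_quotient_ex1\<close> below.\<close>

definition bl_quotient :: "node \<Rightarrow> weight \<Rightarrow> group_algebra" where
  "bl_quotient i \<nu> = (THE f. f * (1 - xpow (- alpha i)) = xpow \<nu> - xpow (reflection i \<nu>))"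

lemma xpow_neg_power: "xpow (- \<alpha>) ^ n = xpow (- int_scale (int n) \<alpha>)"
proof (induction n)
  case 0
  show ?case by (simp add: int_scale_def zero_prod_def [symmetric])
next
  case (Suc n)
  have "- \<alpha> + - int_scale (int n) \<alpha> = - int_scale (int (Suc n)) \<alpha>"
    by (simp add: int_scale_def prod_eq_iff algebra_simps)
  then show ?case by (simp only: power_Suc Suc.IH mult_single mult_1)
qed

lemma geometric_quotient:
  "(xpow \<mu> * (\<Sum>j<n. xpow (- \<alpha>) ^ j)) * (1 - xpow (- \<alpha>))
     = xpow \<mu> - xpow (\<mu> - int_scale (int n) \<alpha>)"
proof -
  have "(xpow \<mu> * (\<Sum>j<n. xpow (- \<alpha>) ^ j)) * (1 - xpow (- \<alpha>))
      = xpow \<mu> * ((1 - xpow (- \<alpha>)) * (\<Sum>j<n. xpow (- \<alpha>) ^ j))"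
    by (simp only: ac_simps)
  also have "\<dots> = xpow \<mu> * (1 - xpow (- \<alpha>) ^ n)"
    by (simp only: one_diff_power_eq [symmetric])
  also have "\<dots> = xpow \<mu> - xpow (\<mu> - int_scale (int n) \<alpha>)"
    by (simp add: xpow_neg_power right_diff_distrib mult_single)
  finally show ?thesis .
qed

lemma lookup_mult_xpow:
  "Poly_Mapping.lookup (g * xpow \<mu>) (k + \<mu>) = Poly_Mapping.lookup (g :: group_algebra) k"
proof (induction g rule: update_induct)
  case const
  show ?case by simp
next
  case (update f a c)
  have "Poly_Mapping.update a c f = f + Poly_Mapping.single a c"
    using update
    by (auto intro!: poly_mapping_eqI
        simp: lookup_add lookup_update lookup_single when_def in_keys_iff)
  with update show ?case
    by (auto simp: distrib_right lookup_add mult_single lookup_single when_def)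
qed

lemma bl_quotient_ex1: "\<exists>!f. f * (1 - xpow (- alpha i)) = xpow \<nu> - xpow (reflection i \<nu>)"
proof (rule ex_ex1I)
  show "\<exists>f. f * (1 - xpow (- alpha i)) = xpow \<nu> - xpow (reflection i \<nu>)"
  proof (cases "pairing \<nu> i \<ge> 0")
    case True
    then have "int (nat (pairing \<nu> i)) = pairing \<nu> i" by simp
    then show ?thesis
      using geometric_quotient [where \<mu> = \<nu> and n = "nat (pairing \<nu> i)" and \<alpha> = "alpha i"]
      unfolding reflection_def by metis
  next
    case False
    define n where "n = nat (- pairing \<nu> i)"
    have "int n = - pairing \<nu> i" using False by (simp add: n_def)
    then have "reflection i \<nu> - int_scale (int n) (alpha i) = \<nu>"
      by (simp add: reflection_def int_scale_def prod_eq_iff)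
    then have "(- (xpow (reflection i \<nu>) * (\<Sum>j<n. xpow (- alpha i) ^ j))) * (1 - xpow (- alpha i))
        = xpow \<nu> - xpow (reflection i \<nu>)"
      using geometric_quotient [where \<mu> = "reflection i \<nu>" and n = n and \<alpha> = "alpha i"]
      by (simp only: mult_minus_left minus_diff_eq)
    then show ?thesis by blast
  qed
next
  fix f f' :: group_algebra
  assume f: "f * (1 - xpow (- alpha i)) = xpow \<nu> - xpow (reflection i \<nu>)"
    and f': "f' * (1 - xpow (- alpha i)) = xpow \<nu> - xpow (reflection i \<nu>)"
  define g where "g = f - f'"
  have "g * (1 - xpow (- alpha i)) = 0" unfolding g_def left_diff_distrib f f' by simp
  then have gY: "g * xpow (- alpha i) = g" by (simp add: right_diff_distrib)
  have gYn: "g * xpow (- int_scale (int n) (alpha i)) = g" for n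
    unfolding xpow_neg_power [symmetric]
    by (induction n) (simp_all add: gY mult.assoc [symmetric])
  have per: "Poly_Mapping.lookup g (k - int_scale (int n) (alpha i)) = Poly_Mapping.lookup g k" for k n
    using lookup_mult_xpow [of g "- int_scale (int n) (alpha i)" k] by (simp add: gYn)
  have "Poly_Mapping.lookup g k = 0" for k
  proof (rule ccontr)
    assume nz: "Poly_Mapping.lookup g k \<noteq> 0"
    have "inj (\<lambda>n. k - int_scale (int n) (alpha i))"
      by (cases i) (auto intro!: injI simp: int_scale_def prod_eq_iff)
    then have "infinite (range (\<lambda>n. k - int_scale (int n) (alpha i)))"
      by (rule range_inj_infinite)
    moreover have "range (\<lambda>n. k - int_scale (int n) (alpha i)) \<subseteq> {k. Poly_Mapping.lookup g k \<noteq> 0}"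
      unfolding image_subset_iff by (simp add: nz per)
    ultimately show False using finite_lookup finite_subset by blast
  qed
  then have "g = 0" by (simp add: poly_mapping_eqI)
  then show "f = f'" by (simp add: g_def)
qed

section \<open>Free associative algebras\<close>

text \<open>The free monoid, written additively so that \<^typ>\<open>'a \<Rightarrow>\<^sub>0 complex\<close> with the convolution product
  of the library becomes its monoid algebra.\<close>

datatype 'a fmonoid = Wd "'a list"

instantiation fmonoid :: (type) monoid_add
begin

definition zero_fmonoid :: "'a fmonoid" where
  "0 = Wd []"

fun plus_fmonoid :: "'a fmonoid \<Rightarrow> 'a fmonoid \<Rightarrow> 'a fmonoid" where
  "Wd u + Wd v = Wd (u @ v)"

instance
proof
  fix a b c :: "'a fmonoid"
  show "a + b + c = a + (b + c)" by (cases a; cases b; cases c) simp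
  show "0 + a = a" by (cases a) (simp add: zero_fmonoid_def)
  show "a + 0 = a" by (cases a) (simp add: zero_fmonoid_def)
qed

end

type_synonym 'a free_algebra = "'a fmonoid \<Rightarrow>\<^sub>0 complex"

definition fgen :: "'a \<Rightarrow> 'a free_algebra" where
  "fgen g = Poly_Mapping.single (Wd [g]) 1"

definition fscalar :: "complex \<Rightarrow> 'a free_algebra" where
  "fscalar c = Poly_Mapping.single 0 c"

lemma ring_free_algebra: "ring (ring_of_type_algebra :: 'a free_algebra ring)"
proof -
  have "\<exists>y. x + y = 0" for x :: "'a free_algebra"
    using add.right_inverse by blast
  then show ?thesis
    unfolding ring_of_type_algebra_def using add.right_inverse
    by unfold_locales (auto simp: algebra_simps Units_def)
qed

section \<open>The affine Hecke algebra\<close>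

datatype hgen = Tgen node | Xgen weight

abbreviation fT :: "node \<Rightarrow> hgen free_algebra" where
  "fT i \<equiv> fgen (Tgen i)"

abbreviation fX :: "weight \<Rightarrow> hgen free_algebra" where
  "fX \<nu> \<equiv> fgen (Xgen \<nu>)"

definition fX_lin :: "group_algebra \<Rightarrow> hgen free_algebra" where
  "fX_lin f = (\<Sum>\<nu>\<in>Poly_Mapping.keys f. fscalar (Poly_Mapping.lookup f \<nu>) * fX \<nu>)"

text \<open>The elements of the free algebra to be set to zero: in this order the quadratic relations,
  the braid relation, the relations of the group algebra and the cross relations.\<close>

definition hecke_relators :: "complex \<Rightarrow> hgen free_algebra set" where
  "hecke_relators q =
     {fT i * fT i - (fscalar (q - inverse q) * fT i + 1) | i. True}
   \<union> {fT N1 * fT N2 * fT N1 * fT N2 - fT N2 * fT N1 * fT N2 * fT N1}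
   \<union> {fX 0 - 1}
   \<union> {fX \<nu> * fX \<mu> - fX (\<nu> + \<mu>) | \<nu> \<mu>. True}
   \<union> {fX \<nu> * fT i
        - (fT i * fX (reflection i \<nu>) + fscalar (q - inverse q) * fX_lin (bl_quotient i \<nu>)) | \<nu> i. True}"

definition hecke_ideal :: "complex \<Rightarrow> hgen free_algebra set" where
  "hecke_ideal q = Idl\<^bsub>ring_of_type_algebra\<^esub> (hecke_relators q)"

definition hecke :: "complex \<Rightarrow> hgen free_algebra set ring" where
  "hecke q = ring_of_type_algebra Quot hecke_ideal q"

definition hclass :: "complex \<Rightarrow> hgen free_algebra \<Rightarrow> hgen free_algebra set" where
  "hclass q a = hecke_ideal q +>\<^bsub>ring_of_type_algebra\<^esub> a"

definition hscale :: "complex \<Rightarrow> complex \<Rightarrow> hgen free_algebra set \<Rightarrow> hgen free_algebra set" where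
  "hscale q c h = hclass q (fscalar c) \<otimes>\<^bsub>hecke q\<^esub> h"

definition hT :: "complex \<Rightarrow> node \<Rightarrow> hgen free_algebra set" where
  "hT q i = hclass q (fT i)"

definition hX :: "complex \<Rightarrow> weight \<Rightarrow> hgen free_algebra set" where
  "hX q \<nu> = hclass q (fX \<nu>)"

lemma ideal_hecke_ideal: "ideal (hecke_ideal q) ring_of_type_algebra"
  unfolding hecke_ideal_def
  by (rule ring.genideal_ideal [OF ring_free_algebra]) (simp add: ring_of_type_algebra_def)

lemma ring_hecke: "ring (hecke q)"
  unfolding hecke_def by (rule ideal.quotient_is_ring [OF ideal_hecke_ideal])

text \<open>The one-dimensional representations are the unital \<open>\<complex>\<close>-algebra homomorphisms to \<open>\<complex>\<close>.
  Requiring them to be extensional makes equality of functions agree with equality on the carrier.\<close>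

definition one_dim_reps :: "complex \<Rightarrow> (hgen free_algebra set \<Rightarrow> complex) set" where
  "one_dim_reps q =
     {\<chi> \<in> extensional (carrier (hecke q)).
        \<chi> \<in> ring_hom (hecke q) ring_of_type_algebra
        \<and> (\<forall>c. \<forall>h \<in> carrier (hecke q). \<chi> (hscale q c h) = c * \<chi> h)}"

end

theory Submission
  imports Defs
begin

text \<open>
  A one-dimensional representation takes values in the commutative field \<open>\<complex>\<close>, so it is nothing but
  an assignment of scalars \<open>t\<^sub>i\<close> to \<open>T\<^sub>i\<close> and \<open>x\<^sup>\<nu>\<close> to \<open>X\<^sup>\<nu>\<close> that satisfies the defining relations: by
  the universal property of the free algebra and of its quotient, recorded in
  \<open>bij_betw_one_dim_reps\<close>, representations and solutions of the relations correspond bijectively.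

  The braid relation holds for any scalars because they commute.  The quadratic relation factors as
  \<open>(t - q) (t + q\<^sup>-\<^sup>1) = 0\<close>.  The relations among the \<open>X\<^sup>\<nu>\<close> make \<open>x\<close> a character of the weight lattice,
  fixed by its values \<open>x\<^sub>1, x\<^sub>2\<close> at the fundamental weights.  The point of the proof is that all cross
  relations for a node \<open>i\<close> together reduce to the single equation \<open>x\<^bsup>\<alpha>\<^sub>i\<^esup> = t\<^sub>i\<^sup>2\<close>
  (\<open>cross_relation_iff\<close>).  At \<open>\<nu> = \<omega>\<^sub>i\<close> the quotient is just \<open>X\<^bsup>\<omega>\<^sub>i\<^esup>\<close>, which gives the equation.
  Conversely, the quadratic relation says \<open>q - q\<^sup>-\<^sup>1 = t\<^sub>i - t\<^sub>i\<^sup>-\<^sup>1 = t\<^sub>i (1 - t\<^sub>i\<^sup>-\<^sup>2)\<close>, so under the equation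
  the factor \<open>q - q\<^sup>-\<^sup>1\<close> is \<open>t\<^sub>i\<close> times the value of the denominator \<open>1 - X\<^bsup>-\<alpha>\<^sub>i\<^esup>\<close>.  It therefore cancels
  the denominator without any division, and the argument is uniform in \<open>q\<close>, including \<open>q\<^sup>2 = 1\<close>,
  where that denominator evaluates to zero.

  Since \<open>\<alpha>\<^sub>1 = 2 \<omega>\<^sub>1 - \<omega>\<^sub>2\<close> and \<open>\<alpha>\<^sub>2 = 2 \<omega>\<^sub>2 - 2 \<omega>\<^sub>1\<close>, what remains is \<open>x\<^sub>1\<^sup>2 / x\<^sub>2 = t\<^sub>1\<^sup>2\<close> and
  \<open>x\<^sub>2\<^sup>2 / x\<^sub>1\<^sup>2 = t\<^sub>2\<^sup>2\<close>.  Multiplying the two gives \<open>x\<^sub>2 = t\<^sub>1\<^sup>2 t\<^sub>2\<^sup>2\<close>, and then \<open>x\<^sub>1 = \<plusminus> t\<^sub>1\<^sup>2 t\<^sub>2\<close>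
  (\<open>root_values_iff\<close>).  The four choices of \<open>(t\<^sub>1, t\<^sub>2)\<close> and the sign give the list.
\<close>

section \<open>Evaluating monoid algebras\<close>

text \<open>The linear extension of a function on the monoid to the monoid algebra.  It serves twice: for
  the group algebra of the weight lattice and for the free algebra, which is the monoid algebra of
  words.\<close>

definition monoid_eval :: "('k \<Rightarrow> complex) \<Rightarrow> ('k \<Rightarrow>\<^sub>0 complex) \<Rightarrow> complex" where
  "monoid_eval m f = (\<Sum>k\<in>Poly_Mapping.keys f. Poly_Mapping.lookup f k * m k)"

text \<open>Reduces additive statements about a monoid algebra to multiples of monoid elements.  The
  library rule \<open>update_induct\<close> changes one coefficient that was zero, and that is the same as adding a
  monomial.\<close>

lemma poly_mapping_additive_induct [case_names single add]:
  fixes f :: "'k \<Rightarrow>\<^sub>0 complex"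
  assumes single: "\<And>k c. P (Poly_Mapping.single k c)"
    and add: "\<And>f g. P f \<Longrightarrow> P g \<Longrightarrow> P (f + g)"
  shows "P f"
proof (induction f rule: update_induct)
  case const
  show ?case using single [of undefined 0] by simp
next
  case (update f a c)
  have "Poly_Mapping.update a c f = f + Poly_Mapping.single a c"
    using update
    by (auto intro!: poly_mapping_eqI
        simp: lookup_add lookup_update lookup_single when_def in_keys_iff)
  then show ?case using add single update.IH by simp
qed

text \<open>The supports of \<open>f\<close>, \<open>g\<close> and \<open>f + g\<close> differ; a common finite index set is what makes the
  defining sums of their evaluations comparable.\<close>

lemma monoid_eval_superset:
  assumes "finite A" "Poly_Mapping.keys f \<subseteq> A"
  shows "monoid_eval m f = (\<Sum>k\<in>A. Poly_Mapping.lookup f k * m k)"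
  unfolding monoid_eval_def
  using assms by (intro sum.mono_neutral_left) (auto simp: in_keys_iff)

lemma monoid_eval_single [simp]: "monoid_eval m (Poly_Mapping.single k c) = c * m k"
  by (simp add: monoid_eval_def)

lemma monoid_eval_zero [simp]: "monoid_eval m 0 = 0"
  by (simp add: monoid_eval_def)

lemma monoid_eval_add [simp]: "monoid_eval m (f + g) = monoid_eval m f + monoid_eval m g"
  using Poly_Mapping.keys_add [of f g]
  by (simp add: monoid_eval_superset [of "Poly_Mapping.keys f \<union> Poly_Mapping.keys g"]
      lookup_add distrib_right sum.distrib)

lemma monoid_eval_uminus [simp]: "monoid_eval m (- f) = - monoid_eval m f"
  using monoid_eval_add [of m f "- f"] by (simp add: add_eq_0_iff del: monoid_eval_add)

lemma monoid_eval_diff [simp]: "monoid_eval m (f - g) = monoid_eval m f - monoid_eval m g"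
  using monoid_eval_add [of m f "- g"] by (simp del: monoid_eval_add)

lemma monoid_eval_sum: "monoid_eval m (sum f A) = (\<Sum>i\<in>A. monoid_eval m (f i))"
  by (induction A rule: infinite_finite_induct) simp_all

lemma monoid_eval_mult:
  fixes f g :: "'k::monoid_add \<Rightarrow>\<^sub>0 complex"
  assumes m: "\<And>k l. m (k + l) = m k * m l"
  shows "monoid_eval m (f * g) = monoid_eval m f * monoid_eval m g"
proof (induction f rule: poly_mapping_additive_induct)
  case (single k c)
  show ?case
    by (induction g rule: poly_mapping_additive_induct)
      (simp_all add: mult_single m distrib_left)
next
  case (add f f')
  then show ?case by (simp add: distrib_right)
qed

fun word_value :: "('a \<Rightarrow> complex) \<Rightarrow> 'a fmonoid \<Rightarrow> complex" where
  "word_value \<phi> (Wd w) = prod_list (map \<phi> w)"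

lemma word_value_zero [simp]: "word_value \<phi> 0 = 1"
  by (simp add: zero_fmonoid_def)

lemma word_value_add: "word_value \<phi> (u + v) = word_value \<phi> u * word_value \<phi> v"
  by (cases u; cases v) simp

abbreviation free_eval :: "('a \<Rightarrow> complex) \<Rightarrow> 'a free_algebra \<Rightarrow> complex" where
  "free_eval \<phi> \<equiv> monoid_eval (word_value \<phi>)"

lemma free_eval_mult [simp]: "free_eval \<phi> (f * g) = free_eval \<phi> f * free_eval \<phi> g"
  by (rule monoid_eval_mult) (rule word_value_add)

lemma free_eval_one [simp]: "free_eval \<phi> 1 = 1"
  by (simp flip: single_one)

lemma free_eval_fgen [simp]: "free_eval \<phi> (fgen g) = \<phi> g"
  by (simp add: fgen_def)

lemma free_eval_fscalar [simp]: "free_eval \<phi> (fscalar c) = c"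
  by (simp add: fscalar_def)

lemma single_word: "Poly_Mapping.single (Wd w) c = fscalar c * prod_list (map fgen w)"
proof (induction w rule: rev_induct)
  case Nil
  show ?case by (simp add: fscalar_def zero_fmonoid_def)
next
  case (snoc g w)
  have "Poly_Mapping.single (Wd (w @ [g])) c = Poly_Mapping.single (Wd w) c * fgen g"
    by (simp add: fgen_def mult_single)
  with snoc show ?case by (simp add: mult.assoc)
qed

text \<open>The uniqueness half of the universal property of the free algebra: words are products of
  generators and span the algebra.\<close>

lemma free_algebra_hom_eq_free_eval:
  fixes \<Phi> :: "'a free_algebra \<Rightarrow> complex"
  assumes add: "\<And>f g. \<Phi> (f + g) = \<Phi> f + \<Phi> g"
    and mult: "\<And>f g. \<Phi> (f * g) = \<Phi> f * \<Phi> g"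
    and scalar: "\<And>c. \<Phi> (fscalar c) = c"
  shows "\<Phi> f = free_eval (\<lambda>g. \<Phi> (fgen g)) f"
proof (induction f rule: poly_mapping_additive_induct)
  case (single k c)
  obtain w where k: "k = Wd w" by (cases k)
  have one: "\<Phi> 1 = 1" using scalar [of 1] by (simp add: fscalar_def)
  have "\<Phi> (prod_list (map fgen w)) = prod_list (map (\<lambda>g. \<Phi> (fgen g)) w)"
    by (induction w) (simp_all add: one mult)
  moreover have "\<Phi> (Poly_Mapping.single k c) = c * \<Phi> (prod_list (map fgen w))"
    by (simp add: k single_word mult scalar)
  ultimately show ?case by (simp add: k)
next
  case (add f g)
  then show ?case by (simp add: assms(1))
qed

section \<open>Characters of the Hecke algebra\<close>

text \<open>The Hecke algebra is handled only through the projection from the free algebra, so that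
  statements about its elements become statements about their representatives.\<close>

lemma hecke_hom: "hclass q \<in> ring_hom ring_of_type_algebra (hecke q)"
  unfolding hclass_def [abs_def] hecke_def by (rule ideal.rcos_ring_hom [OF ideal_hecke_ideal])

lemma carrier_hecke: "carrier (hecke q) = range (hclass q)"
  by (auto simp: hecke_def FactRing_def A_RCOSETS_def' hclass_def ring_of_type_algebra_def)

lemma hclass_add: "hclass q (a + b) = hclass q a \<oplus>\<^bsub>hecke q\<^esub> hclass q b"
  using ring_hom_add [OF hecke_hom, of a b q] by (simp add: ring_of_type_algebra_def)

lemma hclass_mult: "hclass q (a * b) = hclass q a \<otimes>\<^bsub>hecke q\<^esub> hclass q b"
  using ring_hom_mult [OF hecke_hom, of a b q] by (simp add: ring_of_type_algebra_def)

lemma hclass_one: "hclass q 1 = \<one>\<^bsub>hecke q\<^esub>"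
  using ring_hom_one [OF hecke_hom, of q] by (simp add: ring_of_type_algebra_def)

text \<open>Two representatives of one class differ by an element of the ideal; this gives
  well-definedness of maps out of the quotient.\<close>

lemma hclass_eqD:
  assumes "hclass q a = hclass q b"
  shows "\<exists>i\<in>hecke_ideal q. a = i + b"
proof -
  have "0 \<in> hecke_ideal q"
    using additive_subgroup.zero_closed [OF ideal.axioms(1) [OF ideal_hecke_ideal, of q]]
    by (simp add: ring_of_type_algebra_def)
  then have "a \<in> hclass q a"
    by (force simp: hclass_def a_r_coset_def' ring_of_type_algebra_def)
  then show ?thesis
    unfolding assms by (auto simp: hclass_def a_r_coset_def' ring_of_type_algebra_def)
qed

lemma hclass_relator:
  assumes "r \<in> hecke_relators q"
  shows "hclass q r = hclass q 0"
proof -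
  interpret R: ring "ring_of_type_algebra :: hgen free_algebra ring" by (rule ring_free_algebra)
  interpret I: ideal "hecke_ideal q" ring_of_type_algebra by (rule ideal_hecke_ideal)
  have "r \<in> hecke_ideal q"
    using assms R.genideal_self [of "hecke_relators q"]
    by (auto simp: hecke_ideal_def ring_of_type_algebra_def)
  moreover have "0 \<in> hecke_ideal q"
    using I.zero_closed by (simp add: ring_of_type_algebra_def)
  ultimately show ?thesis
    unfolding hclass_def by (simp add: I.a_rcos_const)
qed

text \<open>The kernel of an evaluation is an ideal, so once it contains the relators it contains the
  ideal that they generate.\<close>

lemma free_eval_hecke_ideal:
  assumes "\<forall>r\<in>hecke_relators q. free_eval \<phi> r = 0" and "a \<in> hecke_ideal q"
  shows "free_eval \<phi> a = 0"
proof -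
  have "ring_hom_ring ring_of_type_algebra ring_of_type_algebra (free_eval \<phi>)"
  proof (rule ring_hom_ringI2 [OF ring_free_algebra ring_from_type_algebra])
    show "free_eval \<phi> \<in> ring_hom ring_of_type_algebra ring_of_type_algebra"
      by (rule ring_hom_memI) (simp_all add: ring_of_type_algebra_def)
  qed
  then have "ideal (a_kernel ring_of_type_algebra ring_of_type_algebra (free_eval \<phi>)) ring_of_type_algebra"
    by (rule ring_hom_ring.kernel_is_ideal)
  moreover have kernel: "a_kernel ring_of_type_algebra ring_of_type_algebra (free_eval \<phi>)
      = {a. free_eval \<phi> a = 0}"
    by (simp add: a_kernel_def' ring_of_type_algebra_def)
  ultimately have "hecke_ideal q \<subseteq> {a. free_eval \<phi> a = 0}"
    unfolding hecke_ideal_def using assms(1)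
    by (intro ring.genideal_minimal [OF ring_free_algebra]) auto
  with assms(2) show ?thesis by blast
qed

text \<open>The choice of representative is immaterial when \<open>\<phi>\<close> satisfies the relations, by
  \<open>induced_character_hclass\<close>.  The restriction makes the function extensional, as
  \<^const>\<open>one_dim_reps\<close> demands.\<close>

definition induced_character :: "complex \<Rightarrow> (hgen \<Rightarrow> complex) \<Rightarrow> hgen free_algebra set \<Rightarrow> complex"
  where "induced_character q \<phi> =
    (\<lambda>h\<in>carrier (hecke q). free_eval \<phi> (inv_into UNIV (hclass q) h))"

lemma induced_character_hclass:
  assumes "\<forall>r\<in>hecke_relators q. free_eval \<phi> r = 0"
  shows "induced_character q \<phi> (hclass q a) = free_eval \<phi> a"
proof -
  have "hclass q (inv_into UNIV (hclass q) (hclass q a)) = hclass q a"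
    by (rule f_inv_into_f) simp
  then obtain i where "i \<in> hecke_ideal q" "inv_into UNIV (hclass q) (hclass q a) = i + a"
    using hclass_eqD by blast
  then show ?thesis
    by (simp add: induced_character_def carrier_hecke free_eval_hecke_ideal [OF assms])
qed

text \<open>Pulled back to the free algebra, compatibility with the unit and with scalar multiplication
  amount to fixing the scalars.\<close>

lemma one_dim_reps_iff:
  "\<chi> \<in> one_dim_reps q \<longleftrightarrow> \<chi> \<in> extensional (carrier (hecke q))
     \<and> (\<forall>a b. \<chi> (hclass q (a + b)) = \<chi> (hclass q a) + \<chi> (hclass q b))
     \<and> (\<forall>a b. \<chi> (hclass q (a * b)) = \<chi> (hclass q a) * \<chi> (hclass q b))
     \<and> (\<forall>c. \<chi> (hclass q (fscalar c)) = c)"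
  (is "_ \<longleftrightarrow> ?E \<and> ?A \<and> ?M \<and> ?S")
proof
  assume "\<chi> \<in> one_dim_reps q"
  then have E: ?E and h: "\<chi> \<in> ring_hom (hecke q) ring_of_type_algebra"
    and s: "\<And>c h. h \<in> carrier (hecke q) \<Longrightarrow> \<chi> (hscale q c h) = c * \<chi> h"
    by (auto simp: one_dim_reps_def)
  have A: ?A
    using ring_hom_add [OF h] by (simp add: hclass_add carrier_hecke ring_of_type_algebra_def)
  have M: ?M
    using ring_hom_mult [OF h] by (simp add: hclass_mult carrier_hecke ring_of_type_algebra_def)
  have one: "\<chi> (hclass q 1) = 1"
    using ring_hom_one [OF h] by (simp add: hclass_one ring_of_type_algebra_def)
  have S: ?S
  proof
    fix c
    show "\<chi> (hclass q (fscalar c)) = c"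
      using s [of "hclass q 1" c] by (simp add: hscale_def carrier_hecke one flip: hclass_mult)
  qed
  show "?E \<and> ?A \<and> ?M \<and> ?S" using E A M S by blast
next
  assume *: "?E \<and> ?A \<and> ?M \<and> ?S"
  have one: "\<chi> (hclass q 1) = 1" using * by (metis fscalar_def single_one)
  have "\<chi> \<in> ring_hom (hecke q) ring_of_type_algebra"
    by (rule ring_hom_memI)
      (use * one in \<open>auto simp: carrier_hecke ring_of_type_algebra_def
          simp flip: hclass_add hclass_mult hclass_one\<close>)
  then show "\<chi> \<in> one_dim_reps q"
    using * by (auto simp: one_dim_reps_def carrier_hecke hscale_def simp flip: hclass_mult)
qed

text \<open>The universal property of the presentation: a representation is the same as an assignment of
  scalars to the generators that satisfies the relations.  The inverse map evaluates representatives
  in the free algebra.\<close>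

lemma bij_betw_one_dim_reps:
  "bij_betw (\<lambda>\<chi> g. \<chi> (hclass q (fgen g))) (one_dim_reps q)
     {\<phi>. \<forall>r\<in>hecke_relators q. free_eval \<phi> r = 0}"
proof (rule bij_betw_byWitness [where f' = "induced_character q"])
  have eval: "\<chi> (hclass q a) = free_eval (\<lambda>g. \<chi> (hclass q (fgen g))) a"
    if "\<chi> \<in> one_dim_reps q" for \<chi> a
    using that by (intro free_algebra_hom_eq_free_eval) (auto simp: one_dim_reps_iff)
  have vanish: "\<forall>r\<in>hecke_relators q. free_eval (\<lambda>g. \<chi> (hclass q (fgen g))) r = 0"
    if "\<chi> \<in> one_dim_reps q" for \<chi>
    using eval [OF that] hclass_relator by (metis monoid_eval_zero)
  show "\<forall>\<chi>\<in>one_dim_reps q. induced_character q (\<lambda>g. \<chi> (hclass q (fgen g))) = \<chi>"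
  proof
    fix \<chi> assume \<chi>: "\<chi> \<in> one_dim_reps q"
    show "induced_character q (\<lambda>g. \<chi> (hclass q (fgen g))) = \<chi>"
    proof (rule extensionalityI [where A = "carrier (hecke q)"])
      show "induced_character q (\<lambda>g. \<chi> (hclass q (fgen g))) \<in> extensional (carrier (hecke q))"
        by (simp add: induced_character_def)
      show "\<chi> \<in> extensional (carrier (hecke q))" using \<chi> by (simp add: one_dim_reps_iff)
    next
      fix h assume "h \<in> carrier (hecke q)"
      then show "induced_character q (\<lambda>g. \<chi> (hclass q (fgen g))) h = \<chi> h"
        by (auto simp: carrier_hecke induced_character_hclass [OF vanish [OF \<chi>]] simp flip: eval [OF \<chi>])
    qed
  qed
  show "\<forall>\<phi>\<in>{\<phi>. \<forall>r\<in>hecke_relators q. free_eval \<phi> r = 0}.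
          (\<lambda>g. induced_character q \<phi> (hclass q (fgen g))) = \<phi>"
    by (auto simp: induced_character_hclass)
  show "(\<lambda>\<chi> g. \<chi> (hclass q (fgen g))) ` one_dim_reps q
          \<subseteq> {\<phi>. \<forall>r\<in>hecke_relators q. free_eval \<phi> r = 0}"
    using vanish by auto
  show "induced_character q ` {\<phi>. \<forall>r\<in>hecke_relators q. free_eval \<phi> r = 0} \<subseteq> one_dim_reps q"
    by (auto simp: one_dim_reps_iff induced_character_hclass) (simp add: induced_character_def)
qed

section \<open>The relations evaluated at scalars\<close>

lemma free_eval_fX_lin: "free_eval \<phi> (fX_lin f) = monoid_eval (\<lambda>\<nu>. \<phi> (Xgen \<nu>)) f"
  by (simp add: fX_lin_def monoid_eval_sum monoid_eval_def [of "\<lambda>\<nu>. \<phi> (Xgen \<nu>)"])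

text \<open>Scalars commute, so every assignment satisfies the braid relation and it contributes no equation.\<close>

lemma relators_vanish_iff:
  "(\<forall>r\<in>hecke_relators q. free_eval \<phi> r = 0) \<longleftrightarrow>
     (\<forall>i. \<phi> (Tgen i) * \<phi> (Tgen i) = (q - inverse q) * \<phi> (Tgen i) + 1)
     \<and> \<phi> (Xgen 0) = 1
     \<and> (\<forall>\<nu> \<mu>. \<phi> (Xgen (\<nu> + \<mu>)) = \<phi> (Xgen \<nu>) * \<phi> (Xgen \<mu>))
     \<and> (\<forall>\<nu> i. \<phi> (Xgen \<nu>) * \<phi> (Tgen i) = \<phi> (Tgen i) * \<phi> (Xgen (reflection i \<nu>))
          + (q - inverse q) * monoid_eval (\<lambda>\<nu>. \<phi> (Xgen \<nu>)) (bl_quotient i \<nu>))"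
    (is "_ \<longleftrightarrow> ?equations")
proof -
  let ?\<phi> = "free_eval \<phi>"
  have "(\<forall>r\<in>hecke_relators q. ?\<phi> r = 0) \<longleftrightarrow>
      (\<forall>i. ?\<phi> (fT i * fT i - (fscalar (q - inverse q) * fT i + 1)) = 0)
    \<and> ?\<phi> (fT N1 * fT N2 * fT N1 * fT N2 - fT N2 * fT N1 * fT N2 * fT N1) = 0
    \<and> ?\<phi> (fX 0 - 1) = 0
    \<and> (\<forall>\<nu> \<mu>. ?\<phi> (fX \<nu> * fX \<mu> - fX (\<nu> + \<mu>)) = 0)
    \<and> (\<forall>\<nu> i. ?\<phi> (fX \<nu> * fT i
        - (fT i * fX (reflection i \<nu>) + fscalar (q - inverse q) * fX_lin (bl_quotient i \<nu>))) = 0)"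
    unfolding hecke_relators_def by blast
  also have "\<dots> \<longleftrightarrow> ?equations"
    by (simp add: free_eval_fX_lin eq_commute [of "\<phi> (Xgen (_ + _))"])
  finally show ?thesis .
qed

lemma quadratic_relation_iff:
  fixes q t :: complex
  assumes "q \<noteq> 0"
  shows "t * t = (q - inverse q) * t + 1 \<longleftrightarrow> t = q \<or> t = - inverse q"
proof -
  have "t * t - ((q - inverse q) * t + 1) = (t - q) * (t + inverse q)"
    using assms by (simp add: algebra_simps)
  then show ?thesis
    by (metis add_eq_0_iff2 diff_eq_diff_eq eq_iff_diff_eq_0 mult_eq_0_iff)
qed

lemma bl_quotient: "bl_quotient i \<nu> * (1 - xpow (- alpha i)) = xpow \<nu> - xpow (reflection i \<nu>)"
  unfolding bl_quotient_def by (rule theI' [OF bl_quotient_ex1])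

lemma bl_quotient_omega: "bl_quotient i (omega i) = xpow (omega i)"
proof -
  have "xpow (omega i) * (1 - xpow (- alpha i)) = xpow (omega i) - xpow (reflection i (omega i))"
    by (cases i) (simp_all add: right_diff_distrib mult_single reflection_def int_scale_def)
  then show ?thesis
    using bl_quotient bl_quotient_ex1 by blast
qed

text \<open>Dividing the relation at \<open>\<omega>\<^sub>i\<close> by \<open>x\<^bsup>\<omega>\<^sub>i\<^esup>\<close> gives \<open>t = t x\<^bsup>-\<alpha>\<^sub>i\<^esup> + (t - t\<^sup>-\<^sup>1)\<close>, that is
  \<open>x\<^bsup>\<alpha>\<^sub>i\<^esup> = t\<^sup>2\<close>.  Conversely, evaluating the identity that defines the quotient yields its value times
  \<open>1 - t\<^sup>-\<^sup>2\<close>, and \<open>q - q\<^sup>-\<^sup>1\<close> is \<open>t\<close> times this very factor.\<close>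

lemma cross_relation_iff:
  fixes x :: "weight \<Rightarrow> complex"
  assumes x0: "x 0 = 1" and x_add: "\<And>\<nu> \<mu>. x (\<nu> + \<mu>) = x \<nu> * x \<mu>"
    and t: "t \<noteq> 0" "t * t = (q - inverse q) * t + 1"
  shows "(\<forall>\<nu>. x \<nu> * t = t * x (reflection i \<nu>) + (q - inverse q) * monoid_eval x (bl_quotient i \<nu>))
    \<longleftrightarrow> x (alpha i) = t\<^sup>2"
proof -
  have qt: "q - inverse q = t - inverse t"
    using t by (simp add: field_simps)
  have inv: "x \<nu> * x (- \<nu>) = 1" for \<nu>
    using x_add [of \<nu> "- \<nu>"] x0 by simp
  have nz: "x \<nu> \<noteq> 0" for \<nu>
    using inv [of \<nu>] by auto
  have neg: "x (- \<nu>) = inverse (x \<nu>)" for \<nu>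
    using inv [of \<nu>] nz [of \<nu>] by (simp add: field_simps)
  show ?thesis
  proof
    assume cross: "\<forall>\<nu>. x \<nu> * t = t * x (reflection i \<nu>)
      + (q - inverse q) * monoid_eval x (bl_quotient i \<nu>)"
    have "reflection i (omega i) = omega i + - alpha i"
      by (cases i) (simp_all add: reflection_def int_scale_def)
    then have "x (reflection i (omega i)) = x (omega i) * inverse (x (alpha i))"
      by (simp only: x_add neg)
    then have "x (omega i) * t
        = t * (x (omega i) * inverse (x (alpha i))) + (t - inverse t) * x (omega i)"
      using cross [THEN spec, of "omega i"]
      by (simp add: bl_quotient_omega qt)
    then show "x (alpha i) = t\<^sup>2"
      using nz [of "omega i"] nz [of "alpha i"] t(1)
      by (simp add: field_simps power2_eq_square)
  next
    assume \<alpha>: "x (alpha i) = t\<^sup>2"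
    show "\<forall>\<nu>. x \<nu> * t = t * x (reflection i \<nu>)
      + (q - inverse q) * monoid_eval x (bl_quotient i \<nu>)"
    proof
      fix \<nu>
      have "monoid_eval x (bl_quotient i \<nu>) * (1 - inverse (t\<^sup>2)) = x \<nu> - x (reflection i \<nu>)"
        using arg_cong [OF bl_quotient [of i \<nu>], of "monoid_eval x"]
        by (simp add: monoid_eval_mult [of x, OF x_add] x0 neg \<alpha> flip: single_one)
      moreover have "q - inverse q = t * (1 - inverse (t\<^sup>2))"
        unfolding qt using t(1) by (simp add: field_simps power2_eq_square)
      ultimately have "(q - inverse q) * monoid_eval x (bl_quotient i \<nu>)
          = t * (x \<nu> - x (reflection i \<nu>))"
        by (metis mult.assoc mult.commute)
      then show "x \<nu> * t = t * x (reflection i \<nu>)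
          + (q - inverse q) * monoid_eval x (bl_quotient i \<nu>)"
        by (simp add: algebra_simps)
    qed
  qed
qed

section \<open>Characters of the weight lattice\<close>

lemma int_character_eq_power_int:
  fixes h :: "int \<Rightarrow> complex"
  assumes h0: "h 0 = 1" and h_add: "\<And>m n. h (m + n) = h m * h n"
  shows "h n = h 1 powi n"
proof -
  have nat: "h (int k) = h 1 ^ k" for k
    by (induction k) (simp_all add: h0 h_add)
  show ?thesis
  proof (cases "n \<ge> 0")
    case True
    then show ?thesis using nat [of "nat n"] by (simp add: power_int_def)
  next
    case False
    have "h n * h (- n) = 1" using h_add [of n "- n"] h0 by simp
    then have "h n = inverse (h (- n))" by (metis inverse_unique mult.commute)
    then show ?thesis using nat [of "nat (- n)"] False by (simp add: power_int_def power_inverse)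
  qed
qed

text \<open>The fundamental weights are a basis of the lattice, so a character is a product of characters
  of \<open>\<int>\<close>, one for each.\<close>

lemma weight_character_eq:
  fixes x :: "weight \<Rightarrow> complex"
  assumes x0: "x 0 = 1" and x_add: "\<And>\<nu> \<mu>. x (\<nu> + \<mu>) = x \<nu> * x \<mu>"
  shows "x \<nu> = x (omega N1) powi fst \<nu> * x (omega N2) powi snd \<nu>"
proof -
  have "x \<nu> = x (fst \<nu>, 0) * x (0, snd \<nu>)"
    using x_add [of "(fst \<nu>, 0)" "(0, snd \<nu>)"] by simp
  also have "x (fst \<nu>, 0) = x (1, 0) powi fst \<nu>"
    by (rule int_character_eq_power_int [where h = "\<lambda>n. x (n, 0)"])
      (use x0 x_add in \<open>simp_all add: zero_prod_def flip: x_add\<close>)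
  also have "x (0, snd \<nu>) = x (0, 1) powi snd \<nu>"
    by (rule int_character_eq_power_int [where h = "\<lambda>n. x (0, n)"])
      (use x0 x_add in \<open>simp_all add: zero_prod_def flip: x_add\<close>)
  finally show ?thesis by simp
qed

section \<open>Solving for the scalars\<close>

text \<open>The inverse of reading off the values at \<open>T\<^sub>1\<close>, \<open>T\<^sub>2\<close>, \<open>X\<^bsup>\<omega>\<^sub>1\<^esup>\<close> and \<open>X\<^bsup>\<omega>\<^sub>2\<^esup>\<close>: the assignment to
  all generators that these four values force.\<close>

fun scalar_point :: "complex \<times> complex \<times> complex \<times> complex \<Rightarrow> hgen \<Rightarrow> complex" where
  "scalar_point (t1, t2, x1, x2) (Tgen N1) = t1"
| "scalar_point (t1, t2, x1, x2) (Tgen N2) = t2"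
| "scalar_point (t1, t2, x1, x2) (Xgen \<nu>) = x1 powi fst \<nu> * x2 powi snd \<nu>"

definition scalar_solutions :: "complex \<Rightarrow> (complex \<times> complex \<times> complex \<times> complex) set" where
  "scalar_solutions q = {(t1, t2, x1, x2).
     t1 \<in> {q, - inverse q} \<and> t2 \<in> {q, - inverse q}
     \<and> x1 \<in> {t1\<^sup>2 * t2, - (t1\<^sup>2 * t2)} \<and> x2 = t1\<^sup>2 * t2\<^sup>2}"

text \<open>The two quotients are the values of a character at \<open>\<alpha>\<^sub>1\<close> and \<open>\<alpha>\<^sub>2\<close>.  Their product is \<open>x\<^sub>2\<close>,
  and after that \<open>x\<^sub>1\<close> is a square root of \<open>(t\<^sub>1\<^sup>2 t\<^sub>2)\<^sup>2\<close>; the root lattice has index two in the weight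
  lattice, whence the sign.\<close>

lemma root_values_iff:
  fixes t1 t2 x1 x2 :: complex
  assumes "t1 \<noteq> 0" "t2 \<noteq> 0" "x1 \<noteq> 0" "x2 \<noteq> 0"
  shows "x1\<^sup>2 / x2 = t1\<^sup>2 \<and> x2\<^sup>2 / x1\<^sup>2 = t2\<^sup>2
    \<longleftrightarrow> x1 \<in> {t1\<^sup>2 * t2, - (t1\<^sup>2 * t2)} \<and> x2 = t1\<^sup>2 * t2\<^sup>2"
proof
  assume *: "x1\<^sup>2 / x2 = t1\<^sup>2 \<and> x2\<^sup>2 / x1\<^sup>2 = t2\<^sup>2"
  have "x2 = (x1\<^sup>2 / x2) * (x2\<^sup>2 / x1\<^sup>2)"
    using assms by (simp add: field_simps power2_eq_square)
  then have x2: "x2 = t1\<^sup>2 * t2\<^sup>2" using * by simp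
  have "x1\<^sup>2 = t1\<^sup>2 * x2" using * assms by (simp add: field_simps)
  also have "\<dots> = (t1\<^sup>2 * t2)\<^sup>2" by (simp add: x2 power2_eq_square)
  finally show "x1 \<in> {t1\<^sup>2 * t2, - (t1\<^sup>2 * t2)} \<and> x2 = t1\<^sup>2 * t2\<^sup>2"
    using x2 by (simp add: power2_eq_iff)
next
  assume "x1 \<in> {t1\<^sup>2 * t2, - (t1\<^sup>2 * t2)} \<and> x2 = t1\<^sup>2 * t2\<^sup>2"
  then show "x1\<^sup>2 / x2 = t1\<^sup>2 \<and> x2\<^sup>2 / x1\<^sup>2 = t2\<^sup>2"
    using assms by (auto simp: field_simps power2_eq_square)
qed

lemma relators_vanish_iff_scalar_solution:
  fixes q :: complex
  assumes q: "q \<noteq> 0"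
    and x0: "\<phi> (Xgen 0) = 1" and x_add: "\<And>\<nu> \<mu>. \<phi> (Xgen (\<nu> + \<mu>)) = \<phi> (Xgen \<nu>) * \<phi> (Xgen \<mu>)"
  shows "(\<forall>r\<in>hecke_relators q. free_eval \<phi> r = 0) \<longleftrightarrow>
    (\<phi> (Tgen N1), \<phi> (Tgen N2), \<phi> (Xgen (omega N1)), \<phi> (Xgen (omega N2))) \<in> scalar_solutions q"
    (is "?L \<longleftrightarrow> ?R")
proof -
  have nodes: "(\<forall>i. P i) \<longleftrightarrow> P N1 \<and> P N2" for P
    by (metis node.exhaust)
  have nz: "\<phi> (Xgen \<nu>) \<noteq> 0" for \<nu>
    using x_add [of \<nu> "- \<nu>"] x0 by auto
  have T: "(\<forall>i. \<phi> (Tgen i) * \<phi> (Tgen i) = (q - inverse q) * \<phi> (Tgen i) + 1) \<longleftrightarrow>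
      \<phi> (Tgen N1) \<in> {q, - inverse q} \<and> \<phi> (Tgen N2) \<in> {q, - inverse q}"
    by (simp add: nodes quadratic_relation_iff [OF q])
  have "?L \<longleftrightarrow> (\<forall>i. \<phi> (Tgen i) * \<phi> (Tgen i) = (q - inverse q) * \<phi> (Tgen i) + 1)
      \<and> (\<forall>i \<nu>. \<phi> (Xgen \<nu>) * \<phi> (Tgen i) = \<phi> (Tgen i) * \<phi> (Xgen (reflection i \<nu>))
          + (q - inverse q) * monoid_eval (\<lambda>\<nu>. \<phi> (Xgen \<nu>)) (bl_quotient i \<nu>))"
    unfolding relators_vanish_iff using x0 x_add by blast
  also have "\<dots> \<longleftrightarrow> (\<forall>i. \<phi> (Tgen i) * \<phi> (Tgen i) = (q - inverse q) * \<phi> (Tgen i) + 1)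
      \<and> (\<forall>i. \<phi> (Xgen (alpha i)) = (\<phi> (Tgen i))\<^sup>2)"
  proof (rule conj_cong [OF refl], rule all_cong1)
    fix i
    assume quad: "\<forall>i. \<phi> (Tgen i) * \<phi> (Tgen i) = (q - inverse q) * \<phi> (Tgen i) + 1"
    then have "\<phi> (Tgen i) \<noteq> 0" by (metis mult_zero_right add_0 zero_neq_one)
    then show "(\<forall>\<nu>. \<phi> (Xgen \<nu>) * \<phi> (Tgen i) = \<phi> (Tgen i) * \<phi> (Xgen (reflection i \<nu>))
          + (q - inverse q) * monoid_eval (\<lambda>\<nu>. \<phi> (Xgen \<nu>)) (bl_quotient i \<nu>))
        \<longleftrightarrow> \<phi> (Xgen (alpha i)) = (\<phi> (Tgen i))\<^sup>2"
      using quad x0 x_add by (intro cross_relation_iff) auto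
  qed
  also have "\<dots> \<longleftrightarrow> ?R"
  proof -
    have "\<phi> (Xgen (alpha N1)) = (\<phi> (Xgen (omega N1)))\<^sup>2 / \<phi> (Xgen (omega N2))"
      using weight_character_eq [of "\<lambda>\<nu>. \<phi> (Xgen \<nu>)" "alpha N1", OF x0 x_add]
      by (simp add: power_int_minus divide_inverse)
    moreover have "\<phi> (Xgen (alpha N2)) = (\<phi> (Xgen (omega N2)))\<^sup>2 / (\<phi> (Xgen (omega N1)))\<^sup>2"
      using weight_character_eq [of "\<lambda>\<nu>. \<phi> (Xgen \<nu>)" "alpha N2", OF x0 x_add]
      by (simp add: power_int_minus divide_inverse mult.commute)
    moreover have "\<phi> (Tgen i) \<noteq> 0" if "\<phi> (Tgen i) \<in> {q, - inverse q}" for i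
      using that q by auto
    ultimately show ?thesis
      unfolding T scalar_solutions_def nodes mem_Collect_eq prod.case
      using root_values_iff [of "\<phi> (Tgen N1)" "\<phi> (Tgen N2)",
          OF _ _ nz [of "omega N1"] nz [of "omega N2"]]
      by metis
  qed
  finally show ?thesis .
qed

lemma bij_betw_scalar_solutions:
  fixes q :: complex
  assumes q: "q \<noteq> 0"
  shows "bij_betw (\<lambda>\<phi>. (\<phi> (Tgen N1), \<phi> (Tgen N2), \<phi> (Xgen (omega N1)), \<phi> (Xgen (omega N2))))
    {\<phi>. \<forall>r\<in>hecke_relators q. free_eval \<phi> r = 0} (scalar_solutions q)"
proof (rule bij_betw_byWitness [where f' = scalar_point])
  show "\<forall>\<phi>\<in>{\<phi>. \<forall>r\<in>hecke_relators q. free_eval \<phi> r = 0}.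
      scalar_point (\<phi> (Tgen N1), \<phi> (Tgen N2), \<phi> (Xgen (omega N1)), \<phi> (Xgen (omega N2))) = \<phi>"
  proof (rule ballI, rule ext)
    fix \<phi> g assume "\<phi> \<in> {\<phi>. \<forall>r\<in>hecke_relators q. free_eval \<phi> r = 0}"
    then have "\<phi> (Xgen 0) = 1" "\<And>\<nu> \<mu>. \<phi> (Xgen (\<nu> + \<mu>)) = \<phi> (Xgen \<nu>) * \<phi> (Xgen \<mu>)"
      by (auto simp: relators_vanish_iff)
    note x = weight_character_eq [of "\<lambda>\<nu>. \<phi> (Xgen \<nu>)", OF this, symmetric]
    show "scalar_point (\<phi> (Tgen N1), \<phi> (Tgen N2), \<phi> (Xgen (omega N1)), \<phi> (Xgen (omega N2))) g = \<phi> g"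
    proof (cases g)
      case (Tgen i)
      then show ?thesis by (cases i) simp_all
    next
      case (Xgen \<nu>)
      then show ?thesis using x [of \<nu>] by simp
    qed
  qed
  show "\<forall>p\<in>scalar_solutions q. (scalar_point p (Tgen N1), scalar_point p (Tgen N2),
      scalar_point p (Xgen (omega N1)), scalar_point p (Xgen (omega N2))) = p"
    by auto
  show "(\<lambda>\<phi>. (\<phi> (Tgen N1), \<phi> (Tgen N2), \<phi> (Xgen (omega N1)), \<phi> (Xgen (omega N2))))
      ` {\<phi>. \<forall>r\<in>hecke_relators q. free_eval \<phi> r = 0} \<subseteq> scalar_solutions q"
  proof clarify
    fix \<phi> :: "hgen \<Rightarrow> complex" assume *: "\<forall>r\<in>hecke_relators q. free_eval \<phi> r = 0"
    then have "\<phi> (Xgen 0) = 1" "\<And>\<nu> \<mu>. \<phi> (Xgen (\<nu> + \<mu>)) = \<phi> (Xgen \<nu>) * \<phi> (Xgen \<mu>)"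
      by (auto simp: relators_vanish_iff)
    with * show "(\<phi> (Tgen N1), \<phi> (Tgen N2), \<phi> (Xgen (omega N1)), \<phi> (Xgen (omega N2)))
        \<in> scalar_solutions q"
      using relators_vanish_iff_scalar_solution [OF q, of \<phi>] by blast
  qed
  show "scalar_point ` scalar_solutions q \<subseteq> {\<phi>. \<forall>r\<in>hecke_relators q. free_eval \<phi> r = 0}"
  proof clarify
    fix t1 t2 x1 x2 r
    assume *: "(t1, t2, x1, x2) \<in> scalar_solutions q" and r: "r \<in> hecke_relators q"
    let ?\<phi> = "scalar_point (t1, t2, x1, x2)"
    have "x1 \<noteq> 0" "x2 \<noteq> 0" using * q by (auto simp: scalar_solutions_def)
    then have "?\<phi> (Xgen (\<nu> + \<mu>)) = ?\<phi> (Xgen \<nu>) * ?\<phi> (Xgen \<mu>)" for \<nu> \<mu>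
      by (simp add: power_int_add)
    then show "free_eval ?\<phi> r = 0"
      using relators_vanish_iff_scalar_solution [OF q, of ?\<phi>] * r by auto
  qed
qed

text \<open>Where \<open>t\<^sub>2 = - q\<^sup>-\<^sup>1\<close>, the value \<open>t\<^sub>1\<^sup>2 t\<^sub>2\<close> carries a minus sign, so the label \<open>\<epsilon>\<close> of the listed
  representation is opposite to the sign in \<open>x\<^sub>1 = \<plusminus> t\<^sub>1\<^sup>2 t\<^sub>2\<close>.\<close>

lemma scalar_solutions_eq:
  fixes q :: complex
  assumes "q \<noteq> 0"
  shows "scalar_solutions q = (\<Union>\<epsilon>\<in>{1, -1}.
      {(q, q, \<epsilon> * q powi 3, q powi 4),
       (q, - inverse q, \<epsilon> * q, 1),
       (- inverse q, q, \<epsilon> * inverse q, 1),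
       (- inverse q, - inverse q, \<epsilon> * q powi (-3), q powi (-4))})"
proof -
  define F :: "complex \<Rightarrow> complex \<Rightarrow> complex \<Rightarrow> complex \<times> complex \<times> complex \<times> complex"
    where "F \<epsilon> t1 t2 = (t1, t2, \<epsilon> * (t1\<^sup>2 * t2), t1\<^sup>2 * t2\<^sup>2)" for \<epsilon> t1 t2
  have F: "F \<epsilon> q q = (q, q, \<epsilon> * q powi 3, q powi 4)"
    "F (- \<epsilon>) q (- inverse q) = (q, - inverse q, \<epsilon> * q, 1)"
    "F \<epsilon> (- inverse q) q = (- inverse q, q, \<epsilon> * inverse q, 1)"
    "F (- \<epsilon>) (- inverse q) (- inverse q)
      = (- inverse q, - inverse q, \<epsilon> * q powi (-3), q powi (-4))" for \<epsilon>
    using assms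
    by (simp_all add: F_def power_int_minus field_simps power2_eq_square power3_eq_cube power4_eq_xxxx)
  \<comment> \<open>The regrouping below uses only that there are two roots, not what they are.\<close>
  define r where "r = - inverse q"
  have "{(t1, t2, x1, x2). t1 \<in> S \<and> t2 \<in> S
        \<and> x1 \<in> {t1\<^sup>2 * t2, - (t1\<^sup>2 * t2)} \<and> x2 = t1\<^sup>2 * t2\<^sup>2}
      = (\<Union>t1\<in>S. \<Union>t2\<in>S. {F 1 t1 t2, F (-1) t1 t2})" for S
    by (auto simp: F_def)
  then have "scalar_solutions q = (\<Union>t1\<in>{q, r}. \<Union>t2\<in>{q, r}. {F 1 t1 t2, F (-1) t1 t2})"
    unfolding scalar_solutions_def r_def .
  also have "\<dots> = (\<Union>\<epsilon>\<in>{1, -1}. {F \<epsilon> q q, F (- \<epsilon>) q r, F \<epsilon> r q, F (- \<epsilon>) r r})"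
    by (simp add: insert_commute)
  finally show ?thesis unfolding r_def F .
qed

theorem theorem16:
  fixes q :: complex
  assumes "q \<noteq> 0"
  shows "bij_betw
    (\<lambda>\<chi>. (\<chi> (hT q N1), \<chi> (hT q N2), \<chi> (hX q (omega N1)), \<chi> (hX q (omega N2))))
    (one_dim_reps q)
    (\<Union>\<epsilon>\<in>{1, -1}.
      {(q, q, \<epsilon> * q powi 3, q powi 4),
       (q, - inverse q, \<epsilon> * q, 1),
       (- inverse q, q, \<epsilon> * inverse q, 1),
       (- inverse q, - inverse q, \<epsilon> * q powi (-3), q powi (-4))})"
  using bij_betw_trans [OF bij_betw_one_dim_reps bij_betw_scalar_solutions [OF assms]]
  by (simp add: comp_def hT_def hX_def scalar_solutions_eq [OF assms])

end
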